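(* Let $a_0,\dots,a_7,b_0,\dots,b_7$ be real numbers and let $M$ be an $n$-dimensional $(\mathcal{T}_a,\mathcal{T}_b)$-semisymmetric $(N(k),\xi)$-semi-Riemannian manifold. Then for all vector fields $X,U,V,W$, $$\begin{aligned} &-\varepsilon b_0(ka_0+k(n-1)a_4+a_7r)R(U,V,W,X)-\varepsilon a_1b_0S(X,R(U,V)W)\\ &=-2k(n-1)a_3(kb_0+k(n-1)b_4+b_7r)\eta(X)\eta(U)g(V,W)\\ &\quad-2k(n-1)a_3(-kb_0+k(n-1)b_5-b_7r)\eta(X)\eta(V)g(U,W)\\ &\quad+\varepsilon a_1b_4S^2(X,U)g(V,W)+\varepsilon a_1b_5S^2(X,V)g(U,W)+\varepsilon a_1b_6S^2(X,W)g(U,V)\\ &\quad-a_5(b_1+b_3)S^2(X,V)\eta(U)\eta(W)-a_5(b_1+b_2)S^2(X,W)\eta(U)\eta(V)-a_5(b_2+b_3)S^2(X,U)\eta(V)\eta(W)\\ &\quad-2a_6b_1S^2(V,W)\eta(X)\eta(U)-2a_6b_2S^2(U,W)\eta(X)\eta(V)-2a_6b_3S^2(U,V)\eta(X)\eta(W)\\ &\quad-2k^2(n-1)^2a_3b_6\,g(U,V)\eta(X)\eta(W)\\ &\quad-2\bigl(k(n-1)a_3b_1+a_6(kb_0+k(n-1)b_4+b_7r)\bigr)\eta(X)\eta(U)S(V,W)\\ &\quad-2\bigl(k(n-1)a_3b_2+a_6(-kb_0+k(n-1)b_5-b_7r)\bigr)\eta(X)\eta(V)S(U,W)\\ &\quad-2k(n-1)(a_3b_3+a_6b_6)S(U,V)\eta(X)\eta(W)\\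 &\quad+\varepsilon\bigl(b_4(ka_0+k(n-1)a_4+a_7r)-a_1(kb_0+k(n-1)b_4)\bigr)S(X,U)g(V,W)\\ &\quad+\varepsilon\bigl(b_5(ka_0+k(n-1)a_4+a_7r)-a_1(-kb_0+k(n-1)b_5)\bigr)S(X,V)g(U,W)\\ &\quad+\varepsilon b_6(ka_0+k(n-1)(a_4-a_1)+a_7r)S(X,W)g(U,V)\\ &\quad-\varepsilon(kb_0+k(n-1)b_4)(ka_0+k(n-1)a_4+a_7r)g(X,U)g(V,W)\\ &\quad-\varepsilon(-kb_0+k(n-1)b_5)(ka_0+k(n-1)a_4+a_7r)g(U,W)g(X,V)\\ &\quad-\varepsilon k(n-1)b_6(ka_0+k(n-1)a_4+a_7r)g(X,W)g(U,V)\\ &\quad-k(n-1)\bigl((b_2+b_3)(ka_0+k(n-1)a_4+a_7r)+(a_2+a_4)(-kb_0+k(n-1)(b_5+b_6)-b_7r)\bigr)g(X,U)\eta(V)\eta(W)\\ &\quad-k(n-1)\bigl((b_1+b_3)(ka_0+k(n-1)a_4+a_7r)+(a_2+a_4)(kb_0+k(n-1)(b_4+b_6)+b_7r)\bigr)g(X,V)\eta(U)\eta(W)\\ &\quad-\bigl((b_1+b_3)(-ka_0+k(n-1)(a_1+a_2)-a_7r)+(a_1+a_5)(kb_0+k(n-1)(b_4+b_6)+b_7r)\bigr)S(X,V)\eta(U)\eta(W)\\ &\quad-\bigl((b_2+b_3)(-ka_0+k(n-1)(a_1+a_2)-a_7r)+(a_1+a_5)(-kb_0+k(n-1)(b_5+b_6)-b_7r)\bigr)S(X,U)\eta(V)\eta(W)\\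 &\quad-\bigl((b_1+b_2)(-ka_0+k(n-1)(a_1+a_2)-a_7r)+k(n-1)(b_4+b_5)(a_1+a_5)\bigr)S(X,W)\eta(U)\eta(V)\\ &\quad-k(n-1)\bigl(k(n-1)(b_4+b_5)(a_2+a_4)+(b_1+b_2)(ka_0+k(n-1)a_4+a_7r)\bigr)g(X,W)\eta(U)\eta(V). \end{aligned}$$ In particular, if $M$ is an $n$-dimensional $(\mathcal{T}_a,\mathcal{T}_a)$-semisymmetric $(N(k),\xi)$-semi-Riemannian manifold, then the same identity holds with $b_i$ replaced by $a_i$ for $i=0,\dots,7$.
   Context: Let $(M,g)$ be an $n$-dimensional semi-Riemannian manifold with curvature tensor $R$, Ricci tensor $S$ (with $S(Y,Z)$ the trace of $X\mapsto R(X,Y)Z$), Ricci operator $Q$ ($g(QX,Y)=S(X,Y)$) and scalar curvature $r$; $R(X,Y,Z,V)=g(R(X,Y)Z,V)$ and $S^2(X,Y)=S(QX,Y)$. For real numbers $a_0,\dots,a_7$, the $\mathcal{T}_a$-curvature tensor is $$\mathcal{T}_a(X,Y)Z=a_0R(X,Y)Z+a_1S(Y,Z)X+a_2S(X,Z)Y+a_3S(X,Y)Z+a_4g(Y,Z)QX+a_5g(X,Z)QY+a_6g(X,Y)QZ+a_7r\,(g(Y,Z)X-g(X,Z)Y),$$ and $\mathcal{T}_b$ is the same with $a_i$ replaced by $b_i$. For a real number $k$, the $k$-nullity distribution is $N(k):p\mapsto\{Z\in T_pM: R(X,Y)Z=k(g(Y,Z)X-g(X,Z)Y)\text{ for all }X,Y\in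 T_pM\}$. An $(N(k),\xi)$-semi-Riemannian manifold is a semi-Riemannian manifold with a non-null unit vector field $\xi$ belonging to $N(k)$; $g(\xi,\xi)=\varepsilon=\pm1$ and $\eta(X)=\varepsilon g(X,\xi)$, so $\eta(\xi)=1$. $M$ is $(\mathcal{T}_a,\mathcal{T}_b)$-semisymmetric if $\mathcal{T}_a(X,Y)\cdot\mathcal{T}_b=0$ for all $X,Y$, where $\mathcal{T}_a(X,Y)$ acts as a derivation: $(\mathcal{T}_a(X,Y)\cdot\mathcal{T}_b)(U,V)W=\mathcal{T}_a(X,Y)\mathcal{T}_b(U,V)W-\mathcal{T}_b(\mathcal{T}_a(X,Y)U,V)W-\mathcal{T}_b(U,\mathcal{T}_a(X,Y)V)W-\mathcal{T}_b(U,V)\mathcal{T}_a(X,Y)W$. *)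

theory Defs
  imports "HOL-Analysis.Analysis"
begin

section \<open>Smooth maps between Euclidean spaces\<close>

text \<open>Only meant for open \<open>S\<close>; for a finite-dimensional domain \<open>C_on k S\<close> is the usual class
  \<open>C\<^sup>k\<close>, since all directional derivatives are required to be \<open>C_on (k - 1)\<close>.\<close>

primrec C_on :: "nat \<Rightarrow> 'a::euclidean_space set \<Rightarrow> ('a \<Rightarrow> 'b::euclidean_space) \<Rightarrow> bool" where
  "C_on 0 S f \<longleftrightarrow> continuous_on S f"
| "C_on (Suc k) S f \<longleftrightarrow>
     (\<forall>x\<in>S. f differentiable (at x)) \<and>
     (\<forall>v. C_on k S (\<lambda>x. frechet_derivative f (at x) v))"

definition smooth_on :: "'a::euclidean_space set \<Rightarrow> ('a \<Rightarrow> 'b::euclidean_space) \<Rightarrow> bool" where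
  "smooth_on S f \<longleftrightarrow> (\<forall>k. C_on k S f)"


section \<open>Smooth manifolds\<close>

text \<open>A chart is a pair of its domain and its coordinate map; the coordinate map is irrelevant
  outside the domain. The dimension of the manifold is \<open>CARD('n)\<close>.\<close>

type_synonym ('m, 'n) chart = "'m set \<times> ('m \<Rightarrow> real ^ 'n)"

abbreviation cdom :: "('m, 'n::finite) chart \<Rightarrow> 'm set" where
  "cdom \<equiv> fst"

abbreviation coord :: "('m, 'n::finite) chart \<Rightarrow> 'm \<Rightarrow> real ^ 'n" where
  "coord \<equiv> snd"

definition cimage :: "('m, 'n::finite) chart \<Rightarrow> (real ^ 'n) set" where
  "cimage c = coord c ` cdom c"

definition cinv :: "('m, 'n::finite) chart \<Rightarrow> real ^ 'n \<Rightarrow> 'm" where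
  "cinv c = inv_into (cdom c) (coord c)"

definition is_chart :: "'m topology \<Rightarrow> ('m, 'n::finite) chart \<Rightarrow> bool" where
  "is_chart X c \<longleftrightarrow>
     openin X (cdom c) \<and> open (cimage c) \<and>
     homeomorphic_map (subtopology X (cdom c)) (top_of_set (cimage c)) (coord c)"

text \<open>The field \<open>chart_at\<close> selects a preferred chart around every point, which serves to identify
  the tangent space at \<open>p\<close> with \<open>real ^ 'n\<close>: the vector \<open>v\<close> stands for the tangent vector at \<open>p\<close>
  whose components in the chart \<open>chart_at M p\<close> are \<open>v\<close>. The selection is arbitrary (it need not
  depend on \<open>p\<close> continuously). The atlas need not be maximal.\<close>

record ('m, 'n) mfd =
  mtop :: "'m topology"
  atlas :: "('m, 'n::finite) chart set"
  chart_at :: "'m \<Rightarrow> ('m, 'n) chart"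

abbreviation points :: "('m, 'n::finite) mfd \<Rightarrow> 'm set" where
  "points M \<equiv> topspace (mtop M)"

definition smooth_manifold :: "('m, 'n::finite) mfd \<Rightarrow> bool" where
  "smooth_manifold M \<longleftrightarrow>
     Hausdorff_space (mtop M) \<and> second_countable (mtop M) \<and>
     (\<forall>c\<in>atlas M. is_chart (mtop M) c) \<and>
     (\<forall>c\<in>atlas M. \<forall>d\<in>atlas M. smooth_on (coord c ` (cdom c \<inter> cdom d)) (coord d \<circ> cinv c)) \<and>
     (\<forall>p\<in>points M. chart_at M p \<in> atlas M \<and> p \<in> cdom (chart_at M p))"

text \<open>The differential at \<open>p\<close> of the transition map from \<open>c\<close> to \<open>d\<close>. It turns the components in
  \<open>c\<close> of a tangent vector at \<open>p\<close> into its components in \<open>d\<close>.\<close>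

definition jacobian ::
    "('m, 'n::finite) chart \<Rightarrow> ('m, 'n) chart \<Rightarrow> 'm \<Rightarrow> real ^ 'n \<Rightarrow> real ^ 'n" where
  "jacobian c d p = frechet_derivative (coord d \<circ> cinv c) (at (coord c p))"

definition field_in_chart ::
    "('m, 'n::finite) mfd \<Rightarrow> ('m \<Rightarrow> real ^ 'n) \<Rightarrow> ('m, 'n) chart \<Rightarrow> real ^ 'n \<Rightarrow> real ^ 'n" where
  "field_in_chart M V c x = (let p = cinv c x in jacobian (chart_at M p) c p (V p))"

definition vector_field :: "('m, 'n::finite) mfd \<Rightarrow> ('m \<Rightarrow> real ^ 'n) \<Rightarrow> bool" where
  "vector_field M V \<longleftrightarrow> (\<forall>c\<in>atlas M. smooth_on (cimage c) (field_in_chart M V c))"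


section \<open>Semi-Riemannian metrics\<close>

type_synonym ('m, 'n) metric = "'m \<Rightarrow> real ^ 'n \<Rightarrow> real ^ 'n \<Rightarrow> real"

definition metric_in_chart ::
    "('m, 'n::finite) mfd \<Rightarrow> ('m, 'n) metric \<Rightarrow> ('m, 'n) chart \<Rightarrow>
     real ^ 'n \<Rightarrow> real ^ 'n \<Rightarrow> real ^ 'n \<Rightarrow> real" where
  "metric_in_chart M g c x u v =
     (let p = cinv c x; J = jacobian c (chart_at M p) p in g p (J u) (J v))"

definition form_index :: "(real ^ 'n::finite \<Rightarrow> real ^ 'n \<Rightarrow> real) \<Rightarrow> nat" where
  "form_index B = Max (dim ` {V. subspace V \<and> (\<forall>v\<in>V. v \<noteq> 0 \<longrightarrow> B v v < 0)})"

definition semi_riemannian_manifold :: "('m, 'n::finite) mfd \<Rightarrow> ('m, 'n) metric \<Rightarrow> bool" where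
  "semi_riemannian_manifold M g \<longleftrightarrow>
     smooth_manifold M \<and>
     (\<forall>p\<in>points M. bilinear (g p) \<and> (\<forall>u v. g p u v = g p v u) \<and>
        (\<forall>u. (\<forall>v. g p u v = 0) \<longrightarrow> u = 0)) \<and>
     (\<exists>\<nu>. \<forall>p\<in>points M. form_index (g p) = \<nu>) \<and>
     (\<forall>c\<in>atlas M. \<forall>u v. smooth_on (cimage c) (\<lambda>x. metric_in_chart M g c x u v))"


section \<open>Levi-Civita connection and curvature\<close>

text \<open>In the following definitions \<open>G\<close> is a metric on an open subset of \<open>real ^ 'n\<close>, and
  \<open>X\<close>, \<open>Y\<close>, \<open>Z\<close> are vector fields there. The symbol \<open>christoffel G x u v\<close> is the value at \<open>x\<close> of
  the Levi-Civita derivative of the constant field \<open>v\<close> along the constant field \<open>u\<close>, given by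
  the Koszul formula (the bracket terms vanish for constant fields).\<close>

definition christoffel ::
    "(real ^ 'n \<Rightarrow> real ^ 'n \<Rightarrow> real ^ 'n \<Rightarrow> real) \<Rightarrow>
     real ^ 'n \<Rightarrow> real ^ 'n \<Rightarrow> real ^ 'n \<Rightarrow> real ^ 'n::finite" where
  "christoffel G x u v = (THE z. \<forall>w. 2 * G x z w =
       frechet_derivative (\<lambda>y. G y v w) (at x) u
     + frechet_derivative (\<lambda>y. G y u w) (at x) v
     - frechet_derivative (\<lambda>y. G y u v) (at x) w)"

definition levi_civita ::
    "(real ^ 'n \<Rightarrow> real ^ 'n \<Rightarrow> real ^ 'n \<Rightarrow> real) \<Rightarrow>
     (real ^ 'n \<Rightarrow> real ^ 'n) \<Rightarrow> (real ^ 'n \<Rightarrow> real ^ 'n) \<Rightarrow> real ^ 'n \<Rightarrow> real ^ 'n::finite" where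
  "levi_civita G X Y x = frechet_derivative Y (at x) (X x) + christoffel G x (X x) (Y x)"

definition lie_bracket ::
    "(real ^ 'n \<Rightarrow> real ^ 'n) \<Rightarrow> (real ^ 'n \<Rightarrow> real ^ 'n) \<Rightarrow> real ^ 'n \<Rightarrow> real ^ 'n::finite" where
  "lie_bracket X Y x = frechet_derivative Y (at x) (X x) - frechet_derivative X (at x) (Y x)"

definition curvature_op ::
    "(real ^ 'n \<Rightarrow> real ^ 'n \<Rightarrow> real ^ 'n \<Rightarrow> real) \<Rightarrow>
     (real ^ 'n \<Rightarrow> real ^ 'n) \<Rightarrow> (real ^ 'n \<Rightarrow> real ^ 'n) \<Rightarrow> (real ^ 'n \<Rightarrow> real ^ 'n) \<Rightarrow>
     real ^ 'n \<Rightarrow> real ^ 'n::finite" where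
  "curvature_op G X Y Z x =
     levi_civita G X (levi_civita G Y Z) x - levi_civita G Y (levi_civita G X Z) x
     - levi_civita G (lie_bracket X Y) Z x"

text \<open>By tensoriality the curvature at \<open>p\<close> may be computed with any extensions of the given
  tangent vectors; here they are extended to fields with constant components in \<open>chart_at M p\<close>.\<close>

definition Riem ::
    "('m, 'n::finite) mfd \<Rightarrow> ('m, 'n) metric \<Rightarrow> 'm \<Rightarrow>
     real ^ 'n \<Rightarrow> real ^ 'n \<Rightarrow> real ^ 'n \<Rightarrow> real ^ 'n" where
  "Riem M g p x y z =
     curvature_op (metric_in_chart M g (chart_at M p)) (\<lambda>_. x) (\<lambda>_. y) (\<lambda>_. z)
       (coord (chart_at M p) p)"

definition Riem4 ::
    "('m, 'n::finite) mfd \<Rightarrow> ('m, 'n) metric \<Rightarrow> 'm \<Rightarrow>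
     real ^ 'n \<Rightarrow> real ^ 'n \<Rightarrow> real ^ 'n \<Rightarrow> real ^ 'n \<Rightarrow> real" where
  "Riem4 M g p x y z v = g p (Riem M g p x y z) v"

definition Ricci :: "('m, 'n::finite) mfd \<Rightarrow> ('m, 'n) metric \<Rightarrow> ('m, 'n) metric" where
  "Ricci M g p y z = trace (matrix (\<lambda>x. Riem M g p x y z))"

definition Ricci_op ::
    "('m, 'n::finite) mfd \<Rightarrow> ('m, 'n) metric \<Rightarrow> 'm \<Rightarrow> real ^ 'n \<Rightarrow> real ^ 'n" where
  "Ricci_op M g p x = (THE q. \<forall>y. g p q y = Ricci M g p x y)"

definition Ricci2 :: "('m, 'n::finite) mfd \<Rightarrow> ('m, 'n) metric \<Rightarrow> ('m, 'n) metric" where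
  "Ricci2 M g p x y = Ricci M g p (Ricci_op M g p x) y"

definition scalar_curv :: "('m, 'n::finite) mfd \<Rightarrow> ('m, 'n) metric \<Rightarrow> 'm \<Rightarrow> real" where
  "scalar_curv M g p = trace (matrix (Ricci_op M g p))"


section \<open>The \<open>\<T>\<close>-curvature tensors and semisymmetry\<close>

text \<open>Only the values \<open>a 0, \<dots>, a 7\<close> of the coefficient sequence are used.\<close>

definition T_curv ::
    "('m, 'n::finite) mfd \<Rightarrow> ('m, 'n) metric \<Rightarrow> (nat \<Rightarrow> real) \<Rightarrow> 'm \<Rightarrow>
     real ^ 'n \<Rightarrow> real ^ 'n \<Rightarrow> real ^ 'n \<Rightarrow> real ^ 'n" where
  "T_curv M g a p x y z =
       a 0 *\<^sub>R Riem M g p x y z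
     + (a 1 * Ricci M g p y z) *\<^sub>R x + (a 2 * Ricci M g p x z) *\<^sub>R y
     + (a 3 * Ricci M g p x y) *\<^sub>R z
     + (a 4 * g p y z) *\<^sub>R Ricci_op M g p x + (a 5 * g p x z) *\<^sub>R Ricci_op M g p y
     + (a 6 * g p x y) *\<^sub>R Ricci_op M g p z
     + (a 7 * scalar_curv M g p) *\<^sub>R (g p y z *\<^sub>R x - g p x z *\<^sub>R y)"

definition derivation_action ::
    "('v \<Rightarrow> 'v) \<Rightarrow> ('v \<Rightarrow> 'v \<Rightarrow> 'v \<Rightarrow> 'v) \<Rightarrow> 'v \<Rightarrow> 'v \<Rightarrow> 'v \<Rightarrow> 'v::ab_group_add" where
  "derivation_action A T u v w = A (T u v w) - T (A u) v w - T u (A v) w - T u v (A w)"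

definition T_semisymmetric ::
    "('m, 'n::finite) mfd \<Rightarrow> ('m, 'n) metric \<Rightarrow> (nat \<Rightarrow> real) \<Rightarrow> (nat \<Rightarrow> real) \<Rightarrow> bool" where
  "T_semisymmetric M g a b \<longleftrightarrow>
     (\<forall>p\<in>points M. \<forall>x y u v w.
        derivation_action (T_curv M g a p x y) (T_curv M g b p) u v w = 0)"


section \<open>\<open>k\<close>-nullity and \<open>(N(k),\<xi>)\<close>-semi-Riemannian manifolds\<close>

definition nullity ::
    "('m, 'n::finite) mfd \<Rightarrow> ('m, 'n) metric \<Rightarrow> real \<Rightarrow> 'm \<Rightarrow> (real ^ 'n) set" where
  "nullity M g k p =
     {z. \<forall>x y. Riem M g p x y z = k *\<^sub>R (g p y z *\<^sub>R x - g p x z *\<^sub>R y)}"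

definition Nk_semi_riemannian_manifold ::
    "('m, 'n::finite) mfd \<Rightarrow> ('m, 'n) metric \<Rightarrow> real \<Rightarrow> ('m \<Rightarrow> real ^ 'n) \<Rightarrow> real \<Rightarrow> bool" where
  "Nk_semi_riemannian_manifold M g k \<xi> \<epsilon> \<longleftrightarrow>
     semi_riemannian_manifold M g \<and> vector_field M \<xi> \<and> (\<epsilon> = 1 \<or> \<epsilon> = -1) \<and>
     (\<forall>p\<in>points M. g p (\<xi> p) (\<xi> p) = \<epsilon> \<and> \<xi> p \<in> nullity M g k p)"

definition eta ::
    "('m, 'n::finite) metric \<Rightarrow> ('m \<Rightarrow> real ^ 'n) \<Rightarrow> real \<Rightarrow> 'm \<Rightarrow> real ^ 'n \<Rightarrow> real" where
  "eta g \<xi> \<epsilon> p x = \<epsilon> * g p x (\<xi> p)"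

end

theory Submission
  imports Defs
begin

text \<open>
  The identity is pointwise and linear algebraic. Semisymmetry at a point \<open>p\<close>, applied with \<open>\<xi>\<close> as the
  first argument, says that \<open>\<T>\<^sub>a(\<xi>, X)\<close> acts on \<open>\<T>\<^sub>b\<close> as zero; the claim is the scalar product of
  \<open>(\<T>\<^sub>a(\<xi>, X) \<cdot> \<T>\<^sub>b)(U, V)W = 0\<close> with \<open>\<xi>\<close>, written out. Since \<open>\<xi>\<close> is in the \<open>k\<close>-nullity space,
  \<open>R(X, Y)\<xi>\<close> is explicit. By the symmetries of the curvature tensor so are \<open>R(\<xi>, X)Z\<close> and the
  \<open>\<xi>\<close>-component of \<open>R(X, Y)Z\<close>, and taking traces, \<open>S(X, \<xi>) = k (n - 1) g(X, \<xi>)\<close> and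
  \<open>Q \<xi> = k (n - 1) \<xi>\<close>. Hence the vector \<open>\<T>\<^sub>a(\<xi>, X)Z\<close> and the number \<open>g(\<T>\<^sub>b(X, Y)Z, \<xi>)\<close> are explicit in
  terms of \<open>g\<close>, \<open>S\<close>, \<open>Q\<close> and \<open>\<eta>\<close> (lemmas \<open>T_xi\<close> and \<open>g_T_xi\<close>), and the curvature itself survives only in
  \<open>g(R(U, V)W, X)\<close> and \<open>S(X, R(U, V)W)\<close>, through the pairings of \<open>\<T>\<^sub>b(U, V)W\<close> with \<open>X\<close>.

  What has to be supplied about the geometry is that the curvature tensor, which is defined by
  differentiating the Christoffel symbols of the metric in a chart, has the algebraic symmetries. In
  a chart, the Koszul formula makes the symbols symmetric, which gives the Bianchi identity
  (\<open>curv_bianchi\<close>), and it makes them compatible with the metric. Differentiating compatibility once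
  more and using the symmetry of second derivatives gives \<open>g(R(X, Y)Z, W) = - g(R(X, Y)W, Z)\<close>
  (\<open>curv_skew\<close>). That step needs the Christoffel symbols to be differentiable, which follows from
  Cramer's rule. Pair symmetry and the symmetry of the Ricci tensor are then algebra.
\<close>


section \<open>Symmetry of second derivatives\<close>

lemma has_real_derivative_along_line:
  fixes f :: "'a::euclidean_space \<Rightarrow> real"
  assumes "f differentiable (at (y + s *\<^sub>R a))"
  shows "((\<lambda>s. f (y + s *\<^sub>R a)) has_real_derivative
           frechet_derivative f (at (y + s *\<^sub>R a)) a) (at s)"
proof -
  let ?F = "frechet_derivative f (at (y + s *\<^sub>R a))"
  have F: "(f has_derivative ?F) (at (y + s *\<^sub>R a))"
    using assms frechet_derivative_works by blast
  have "((\<lambda>s. y + s *\<^sub>R a) has_derivative (\<lambda>t. t *\<^sub>R a)) (at s)"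
    by (auto intro!: derivative_eq_intros)
  then have "((\<lambda>s. f (y + s *\<^sub>R a)) has_derivative (\<lambda>t. ?F (t *\<^sub>R a))) (at s)"
    using has_derivative_compose F by fastforce
  moreover have "(\<lambda>t. ?F (t *\<^sub>R a)) = (*) (?F a)"
    using linear_frechet_derivative[OF assms] by (auto simp: linear_cmul)
  ultimately show ?thesis
    by (simp add: has_field_derivative_def)
qed

lemma C_on_2_iff:
  "C_on 2 S f \<longleftrightarrow> (\<forall>x\<in>S. f differentiable (at x)) \<and>
     (\<forall>v. (\<forall>x\<in>S. (\<lambda>x. frechet_derivative f (at x) v) differentiable (at x)) \<and>
       (\<forall>w. continuous_on S (\<lambda>x. frechet_derivative (\<lambda>x. frechet_derivative f (at x) v) (at x) w)))"
  by (simp add: numeral_2_eq_2)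

lemma C_on_subset: "C_on k S f \<Longrightarrow> T \<subseteq> S \<Longrightarrow> C_on k T f"
  by (induction k arbitrary: f) (auto intro: continuous_on_subset)

text \<open>Two applications of the mean value theorem, first along \<open>a\<close> and then along \<open>b\<close>. The left-hand
  side is symmetric in \<open>a\<close> and \<open>b\<close>.\<close>

lemma second_difference_mvt:
  fixes f :: "'a::euclidean_space \<Rightarrow> real"
  assumes f: "C_on 2 S f" and h: "h > 0"
    and S: "\<And>s t. 0 \<le> s \<Longrightarrow> s \<le> h \<Longrightarrow> 0 \<le> t \<Longrightarrow> t \<le> h \<Longrightarrow> x + s *\<^sub>R a + t *\<^sub>R b \<in> S"
  obtains s t where "0 < s" "s < h" "0 < t" "t < h"
    "f (x + h *\<^sub>R a + h *\<^sub>R b) - f (x + h *\<^sub>R a) - f (x + h *\<^sub>R b) + f x =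
      h\<^sup>2 * frechet_derivative (\<lambda>y. frechet_derivative f (at y) a) (at (x + s *\<^sub>R a + t *\<^sub>R b)) b"
proof -
  let ?D = "\<lambda>y. frechet_derivative f (at y) a"
  let ?\<psi> = "\<lambda>s. f (x + h *\<^sub>R b + s *\<^sub>R a) - f (x + s *\<^sub>R a)"
  have d: "f differentiable (at y)" "?D differentiable (at y)" if "y \<in> S" for y
    using f that unfolding C_on_2_iff by auto
  have S': "x + h *\<^sub>R b + s *\<^sub>R a \<in> S" "x + s *\<^sub>R a \<in> S" if "0 \<le> s" "s \<le> h" for s
    using S[of s h] S[of s 0] that h by (auto simp: algebra_simps)
  have "(?\<psi> has_real_derivative ?D (x + h *\<^sub>R b + s *\<^sub>R a) - ?D (x + s *\<^sub>R a)) (at s)"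
    if "0 \<le> s" "s \<le> h" for s
    by (intro DERIV_diff has_real_derivative_along_line d S' that)
  from MVT2[OF h this] obtain s where s: "0 < s" "s < h"
    and 1: "?\<psi> h - ?\<psi> 0 = (h - 0) * (?D (x + h *\<^sub>R b + s *\<^sub>R a) - ?D (x + s *\<^sub>R a))"
    by blast
  have "((\<lambda>t. ?D (x + s *\<^sub>R a + t *\<^sub>R b)) has_real_derivative
      frechet_derivative ?D (at (x + s *\<^sub>R a + t *\<^sub>R b)) b) (at t)" if "0 \<le> t" "t \<le> h" for t
    using s that by (intro has_real_derivative_along_line d S) auto
  from MVT2[OF h this] obtain t where t: "0 < t" "t < h"
    and 2: "?D (x + s *\<^sub>R a + h *\<^sub>R b) - ?D (x + s *\<^sub>R a + 0 *\<^sub>R b) =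
      (h - 0) * frechet_derivative ?D (at (x + s *\<^sub>R a + t *\<^sub>R b)) b"
    by blast
  have "x + h *\<^sub>R b + s *\<^sub>R a = x + s *\<^sub>R a + h *\<^sub>R b" "x + h *\<^sub>R b + h *\<^sub>R a = x + h *\<^sub>R a + h *\<^sub>R b"
    by (auto simp: algebra_simps)
  with 1 2 have "f (x + h *\<^sub>R a + h *\<^sub>R b) - f (x + h *\<^sub>R a) - f (x + h *\<^sub>R b) + f x =
      h\<^sup>2 * frechet_derivative ?D (at (x + s *\<^sub>R a + t *\<^sub>R b)) b"
    by (simp add: power2_eq_square)
  with s t that show thesis by blast
qed

text \<open>Schwarz's theorem. The second difference of side \<open>h\<close> equals \<open>h\<^sup>2\<close> times each of the two mixed
  derivatives, taken at points that tend to \<open>x\<close> with \<open>h\<close>.\<close>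

theorem second_derivative_symmetric:
  fixes f :: "'a::euclidean_space \<Rightarrow> real"
  assumes f: "C_on 2 S f" and S: "open S" "x \<in> S"
  shows "frechet_derivative (\<lambda>y. frechet_derivative f (at y) a) (at x) b =
         frechet_derivative (\<lambda>y. frechet_derivative f (at y) b) (at x) a" (is "?A x = ?B x")
proof (rule ccontr)
  assume "?A x \<noteq> ?B x"
  define e where "e = dist (?A x) (?B x) / 2"
  have e: "e > 0" using \<open>?A x \<noteq> ?B x\<close> by (simp add: e_def)
  have "continuous (at x) ?A" "continuous (at x) ?B"
    using f S unfolding C_on_2_iff continuous_on_eq_continuous_at[OF S(1)] by blast+
  then have "\<exists>d>0. \<forall>y. dist y x < d \<longrightarrow> dist (?A y) (?A x) < e"
    "\<exists>d>0. \<forall>y. dist y x < d \<longrightarrow> dist (?B y) (?B x) < e"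
    unfolding continuous_at_eps_delta using e by blast+
  then obtain d1 d2 where d12: "d1 > 0" "d2 > 0"
    "\<And>y. dist y x < d1 \<Longrightarrow> dist (?A y) (?A x) < e" "\<And>y. dist y x < d2 \<Longrightarrow> dist (?B y) (?B x) < e"
    by blast
  obtain d3 where d3: "d3 > 0" "ball x d3 \<subseteq> S"
    using S open_contains_ball by blast
  define d where "d = min d1 (min d2 d3)"
  define h where "h = d / (norm a + norm b + 1) / 2"
  have d: "d > 0" using d12 d3 by (simp add: d_def)
  then have h: "h > 0" by (simp add: h_def add_nonneg_pos)
  \<comment> \<open>The parallelogram of side \<open>h\<close> stays in the ball around \<open>x\<close> on which both mixed derivatives vary
    by less than \<open>e\<close>, half of their supposed distance at \<open>x\<close>.\<close>
  have near: "dist (x + s *\<^sub>R a + t *\<^sub>R b) x < d"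
    if "0 \<le> s" "s \<le> h" "0 \<le> t" "t \<le> h" for s t
  proof -
    have "dist (x + s *\<^sub>R a + t *\<^sub>R b) x = norm (s *\<^sub>R a + t *\<^sub>R b)"
      by (simp add: dist_norm algebra_simps)
    also have "\<dots> \<le> s * norm a + t * norm b"
      using norm_triangle_ineq[of "s *\<^sub>R a" "t *\<^sub>R b"] that by simp
    also have "\<dots> \<le> h * norm a + h * norm b"
      using that by (intro add_mono mult_right_mono) auto
    also have "\<dots> \<le> h * (norm a + norm b + 1)"
      using h by (simp add: algebra_simps)
    also have "\<dots> = d / 2"
    proof -
      have "norm a + norm b + 1 > 0" by (simp add: add_nonneg_pos)
      then show ?thesis by (simp add: h_def field_simps)
    qed
    finally show ?thesis using d by simp
  qed
  have inS: "x + s *\<^sub>R a + t *\<^sub>R b \<in> S" if "0 \<le> s" "s \<le> h" "0 \<le> t" "t \<le> h" for s t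
    using near[OF that] d3 by (auto simp: d_def dist_commute)
  obtain s t where st: "0 < s" "s < h" "0 < t" "t < h"
    "f (x + h *\<^sub>R a + h *\<^sub>R b) - f (x + h *\<^sub>R a) - f (x + h *\<^sub>R b) + f x =
      h\<^sup>2 * ?A (x + s *\<^sub>R a + t *\<^sub>R b)"
    using second_difference_mvt[OF f h inS] by blast
  have "x + s *\<^sub>R b + t *\<^sub>R a \<in> S" if "0 \<le> s" "s \<le> h" "0 \<le> t" "t \<le> h" for s t
    using inS[of t s] that by (simp add: algebra_simps)
  from second_difference_mvt[OF f h this] obtain s' t' where st':
    "0 < s'" "s' < h" "0 < t'" "t' < h"
    "f (x + h *\<^sub>R b + h *\<^sub>R a) - f (x + h *\<^sub>R b) - f (x + h *\<^sub>R a) + f x =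
      h\<^sup>2 * ?B (x + s' *\<^sub>R b + t' *\<^sub>R a)"
    by blast
  have comm: "x + h *\<^sub>R b + h *\<^sub>R a = x + h *\<^sub>R a + h *\<^sub>R b"
    "x + s' *\<^sub>R b + t' *\<^sub>R a = x + t' *\<^sub>R a + s' *\<^sub>R b" by (auto simp: algebra_simps)
  have "h\<^sup>2 * ?A (x + s *\<^sub>R a + t *\<^sub>R b) = h\<^sup>2 * ?B (x + t' *\<^sub>R a + s' *\<^sub>R b)"
    using st(5) st'(5) unfolding comm by linarith
  then have "?A (x + s *\<^sub>R a + t *\<^sub>R b) = ?B (x + t' *\<^sub>R a + s' *\<^sub>R b)"
    using h by simp
  moreover have "dist (?A (x + s *\<^sub>R a + t *\<^sub>R b)) (?A x) < e"
    using near[of s t] st by (intro d12) (auto simp: d_def)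
  moreover have "dist (?B (x + t' *\<^sub>R a + s' *\<^sub>R b)) (?B x) < e"
    using near[of t' s'] st' by (intro d12) (auto simp: d_def)
  ultimately have "dist (?A x) (?B x) < e + e"
    unfolding dist_real_def by linarith
  then show False by (simp add: e_def)
qed


section \<open>Nondegenerate bilinear forms\<close>

text \<open>The Gram matrix of \<open>B\<close> in the standard basis, indexed so that \<open>gram B *v u\<close> is the vector of the
  values \<open>B u (axis j 1)\<close>.\<close>

definition gram :: "(real ^ 'n \<Rightarrow> real ^ 'n \<Rightarrow> real) \<Rightarrow> real ^ 'n ^ 'n::finite" where
  "gram B = (\<chi> j i. B (axis i 1) (axis j 1))"

lemma bilinear_sum_left: "bilinear B \<Longrightarrow> B (\<Sum>i\<in>I. f i) v = (\<Sum>i\<in>I. B (f i) v)"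
  unfolding bilinear_def using linear_sum[of "\<lambda>x. B x v"] by blast

lemma bilinear_expand_left:
  fixes B :: "real ^ 'n::finite \<Rightarrow> 'b::real_vector \<Rightarrow> real"
  assumes "bilinear B"
  shows "B u v = (\<Sum>i\<in>UNIV. u $ i * B (axis i 1) v)"
proof -
  have "B u v = B (\<Sum>i\<in>UNIV. u $ i *\<^sub>R axis i 1) v"
    using basis_expansion[of u] by (simp add: scalar_mult_eq_scaleR)
  then show ?thesis
    by (simp add: bilinear_sum_left[OF assms] bilinear_lmul[OF assms])
qed

lemma gram_mult: "bilinear B \<Longrightarrow> (gram B *v u) $ j = B u (axis j 1)"
  by (simp add: gram_def matrix_vector_mult_def bilinear_expand_left[of B u] mult.commute)

lemma linear_eq_on_axes:
  fixes f h :: "real ^ 'n::finite \<Rightarrow> real"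
  assumes "linear f" "linear h" "\<And>j. f (axis j 1) = h (axis j 1)"
  shows "f = h"
  by (rule linear_eq_stdbasis) (use assms in \<open>auto simp: Basis_vec_def\<close>)

text \<open>Representing \<open>f\<close> through \<open>B\<close> is solving a linear system, so that Cramer's rule applies.\<close>

lemma gram_solves:
  assumes "bilinear B" "linear f"
  shows "gram B *v z = (\<chi> j. f (axis j 1)) \<longleftrightarrow> (\<forall>w. B z w = f w)"
proof
  assume "gram B *v z = (\<chi> j. f (axis j 1))"
  then have "B z (axis j 1) = f (axis j 1)" for j
    using gram_mult[OF assms(1), of z j] by simp
  moreover have "linear (B z)" using assms(1) by (simp add: bilinear_def)
  ultimately show "\<forall>w. B z w = f w"
    using linear_eq_on_axes assms(2) by metis
qed (simp add: vec_eq_iff gram_mult[OF assms(1)])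

lemma nondegenerate_iff_det_gram:
  assumes "bilinear B"
  shows "(\<forall>u. (\<forall>v. B u v = 0) \<longrightarrow> u = 0) \<longleftrightarrow> det (gram B) \<noteq> 0"
proof -
  have "(\<forall>v. B u v = 0) \<longleftrightarrow> gram B *v u = 0" for u
    using gram_solves[OF assms linear_zero, of u] by (simp add: zero_vec_def)
  then show ?thesis
    by (metis invertible_det_nz matrix_left_invertible_ker invertible_left_inverse)
qed

lemma riesz_nondegenerate:
  fixes B :: "real ^ 'n::finite \<Rightarrow> real ^ 'n \<Rightarrow> real"
  assumes "bilinear B" "\<And>u. (\<And>v. B u v = 0) \<Longrightarrow> u = 0" "linear f"
  shows "\<exists>!z. \<forall>w. B z w = f w"
proof -
  have "det (gram B) \<noteq> 0" using nondegenerate_iff_det_gram[OF assms(1)] assms(2) by blast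
  from cramer[OF this] show ?thesis
    by (simp add: gram_solves[OF assms(1,3), symmetric])
qed


section \<open>Curvature of a metric on an open set\<close>

lemma differentiable_prod:
  fixes f :: "'i \<Rightarrow> 'a::real_normed_vector \<Rightarrow> real"
  assumes "finite I" "\<And>i. i \<in> I \<Longrightarrow> f i differentiable (at x)"
  shows "(\<lambda>y. \<Prod>i\<in>I. f i y) differentiable (at x)"
  using assms by (induction I rule: finite_induct) auto

lemma differentiable_det:
  fixes A :: "'a::real_normed_vector \<Rightarrow> real ^ 'n ^ 'n::finite"
  assumes "\<And>i j. (\<lambda>y. A y $ i $ j) differentiable (at x)"
  shows "(\<lambda>y. det (A y)) differentiable (at x)"
  unfolding det_def
  by (intro differentiable_sum ballI differentiable_mult differentiable_prod differentiable_const assms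
      finite_permutations finite)

text \<open>A semi-Riemannian metric on an open subset of \<open>real ^ 'n\<close>, of class \<open>C\<^sup>2\<close>.\<close>

locale local_metric =
  fixes G :: "real ^ 'n \<Rightarrow> real ^ 'n \<Rightarrow> real ^ 'n::finite \<Rightarrow> real" and \<Omega> :: "(real ^ 'n) set"
  assumes open_domain: "open \<Omega>"
    and bilin: "y \<in> \<Omega> \<Longrightarrow> bilinear (G y)"
    and sym: "y \<in> \<Omega> \<Longrightarrow> G y u v = G y v u"
    and nondeg: "y \<in> \<Omega> \<Longrightarrow> (\<And>v. G y u v = 0) \<Longrightarrow> u = 0"
    and C2: "C_on 2 \<Omega> (\<lambda>y. G y u v)"
begin

abbreviation dG :: "real ^ 'n \<Rightarrow> real ^ 'n \<Rightarrow> real ^ 'n \<Rightarrow> real ^ 'n \<Rightarrow> real" where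
  "dG y a u v \<equiv> frechet_derivative (\<lambda>y. G y u v) (at y) a"

abbreviation \<Gamma> :: "real ^ 'n \<Rightarrow> real ^ 'n \<Rightarrow> real ^ 'n \<Rightarrow> real ^ 'n" where
  "\<Gamma> \<equiv> christoffel G"

lemma has_derivative_G:
  "y \<in> \<Omega> \<Longrightarrow> ((\<lambda>y. G y u v) has_derivative (\<lambda>a. dG y a u v)) (at y)"
  using C2 unfolding C_on_2_iff frechet_derivative_works by blast

lemma dG_differentiable: "y \<in> \<Omega> \<Longrightarrow> (\<lambda>y. dG y a u v) differentiable (at y)"
  using C2 unfolding C_on_2_iff by blast

lemma dG_eqI:
  assumes "y \<in> \<Omega>" "(f has_derivative f') (at y)" "\<And>y. y \<in> \<Omega> \<Longrightarrow> f y = G y u v"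
  shows "dG y a u v = f' a"
proof -
  have "((\<lambda>y. G y u v) has_derivative f') (at y)"
    by (rule has_derivative_transform_within_open[OF assms(2) open_domain assms(1,3)])
  from frechet_derivative_at[OF this] show ?thesis by simp
qed

lemma dG_sym:
  assumes "y \<in> \<Omega>" shows "dG y a u v = dG y a v u"
  by (rule dG_eqI[OF assms has_derivative_G[OF assms]]) (rule sym)

lemma linear_dG_right: "y \<in> \<Omega> \<Longrightarrow> linear (dG y a u)"
proof (rule linearI)
  fix v w assume y: "y \<in> \<Omega>"
  show "dG y a u (v + w) = dG y a u v + dG y a u w"
    by (rule dG_eqI[OF y has_derivative_add[OF has_derivative_G[OF y] has_derivative_G[OF y]]])
      (simp add: bilinear_radd bilin)
next
  fix c v assume y: "y \<in> \<Omega>"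
  show "dG y a u (c *\<^sub>R v) = c *\<^sub>R dG y a u v"
    by (rule dG_eqI[OF y has_derivative_scaleR_right[OF has_derivative_G[OF y]]])
      (simp add: bilinear_rmul bilin)
qed

lemma bilinear_dG:
  assumes "y \<in> \<Omega>" shows "bilinear (dG y a)"
proof -
  have "(\<lambda>u. dG y a u v) = dG y a v" for v
    using dG_sym[OF assms] by blast
  then show ?thesis
    using linear_dG_right[OF assms] by (simp add: bilinear_def)
qed

lemma dG_zero_left: "y \<in> \<Omega> \<Longrightarrow> dG y a 0 v = 0"
  by (rule bilinear_lzero[OF bilinear_dG])

lemma linear_dG_direction: "y \<in> \<Omega> \<Longrightarrow> linear (\<lambda>a. dG y a u v)"
  by (rule has_derivative_linear[OF has_derivative_G])

text \<open>The right-hand side of the Koszul formula for constant fields, including the factor \<open>1 / 2\<close>.\<close>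

definition koszul :: "real ^ 'n \<Rightarrow> real ^ 'n \<Rightarrow> real ^ 'n \<Rightarrow> real ^ 'n \<Rightarrow> real" where
  "koszul y u v w = (dG y u v w + dG y v u w - dG y w u v) / 2"

lemma linear_koszul:
  assumes "y \<in> \<Omega>" shows "linear (koszul y u v)"
proof -
  note l = linear_dG_right[OF assms, of u v] linear_dG_right[OF assms, of v u]
    linear_dG_direction[OF assms, of u v]
  show ?thesis
    unfolding koszul_def
    by (rule linearI) (simp_all add: l[THEN linear_add] l[THEN linear_cmul] field_simps)
qed

lemma christoffel_koszul:
  assumes "y \<in> \<Omega>"
  shows "G y (\<Gamma> y u v) w = koszul y u v w"
proof -
  have ex: "\<exists>!z. \<forall>w. G y z w = koszul y u v w"
    by (rule riesz_nondegenerate[OF bilin[OF assms] nondeg[OF assms] linear_koszul[OF assms]])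
  have "2 * G y z w = dG y u v w + dG y v u w - dG y w u v \<longleftrightarrow> G y z w = koszul y u v w" for z w
    by (auto simp: koszul_def)
  then have "\<Gamma> y u v = (THE z. \<forall>w. G y z w = koszul y u v w)"
    by (simp only: christoffel_def)
  with theI'[OF ex] show ?thesis by simp
qed

lemma eq_by_pairing:
  assumes "y \<in> \<Omega>" "\<And>w. G y u w = G y v w"
  shows "u = v"
proof -
  have "G y (u - v) w = 0" for w
    unfolding bilinear_lsub[OF bilin[OF assms(1)]] assms(2) by simp
  then have "u - v = 0" by (rule nondeg[OF assms(1)])
  then show ?thesis by simp
qed

lemma christoffel_sym:
  assumes y: "y \<in> \<Omega>"
  shows "\<Gamma> y u v = \<Gamma> y v u"
proof (rule eq_by_pairing[OF y])
  fix w
  show "G y (\<Gamma> y u v) w = G y (\<Gamma> y v u) w"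
    unfolding christoffel_koszul[OF y] koszul_def dG_sym[OF y, where u = v and v = u] by simp
qed

lemma christoffel_zero:
  assumes y: "y \<in> \<Omega>"
  shows "\<Gamma> y 0 v = 0"
proof (rule eq_by_pairing[OF y])
  fix w
  show "G y (\<Gamma> y 0 v) w = G y 0 w"
    unfolding christoffel_koszul[OF y] koszul_def bilinear_lzero[OF bilin[OF y]]
      dG_zero_left[OF y] linear_0[OF linear_dG_direction[OF y]] by simp
qed

lemma metric_compatible:
  assumes y: "y \<in> \<Omega>"
  shows "dG y a u v = G y (\<Gamma> y a u) v + G y u (\<Gamma> y a v)"
proof -
  have "G y (\<Gamma> y a u) v + G y (\<Gamma> y a v) u = dG y a u v"
    unfolding christoffel_koszul[OF y] koszul_def
    using dG_sym[OF y, of u v a] dG_sym[OF y, of a v u] dG_sym[OF y, of u a v] by argo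
  then show ?thesis using sym[OF y] by metis
qed

text \<open>Cramer's rule exhibits the components of \<open>\<Gamma> y u v\<close> as quotients of determinants whose entries are
  values and first derivatives of the metric.\<close>

lemma christoffel_differentiable:
  assumes x: "x \<in> \<Omega>"
  shows "(\<lambda>y. \<Gamma> y u v) differentiable (at x)"
proof -
  define c where "c y = (\<chi> j. koszul y u v (axis j 1))" for y
  define N where "N y k = (\<chi> i j. if j = k then c y $ i else gram (G y) $ i $ j)" for y k
  have det: "det (gram (G y)) \<noteq> 0" if "y \<in> \<Omega>" for y
    using nondegenerate_iff_det_gram[OF bilin[OF that]] nondeg[OF that] by blast
  have "gram (G y) *v \<Gamma> y u v = c y" if "y \<in> \<Omega>" for y
    using gram_solves[OF bilin linear_koszul] christoffel_koszul that unfolding c_def by blast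
  then have sol: "\<Gamma> y u v = (\<chi> k. det (N y k) / det (gram (G y)))" if "y \<in> \<Omega>" for y
    using cramer[OF det[OF that]] that unfolding N_def by blast
  have "c y $ i = (dG y u v (axis i 1) + dG y v u (axis i 1) - dG y (axis i 1) u v) * (1/2)" for y i
    by (simp add: c_def koszul_def)
  then have c: "(\<lambda>y. c y $ i) differentiable (at x)" for i
    by (simp only:) (intro differentiable_add differentiable_diff differentiable_mult
      differentiable_const dG_differentiable x)
  have gr: "(\<lambda>y. gram (G y) $ i $ j) differentiable (at x)" for i j
    using has_derivative_G[OF x] by (auto simp: gram_def differentiable_def)
  have "(\<lambda>y. N y k $ i $ j) differentiable (at x)" for k i j
    using c gr by (cases "j = k") (simp_all add: N_def)
  then have "(\<lambda>y. (det (N y k) * inverse (det (gram (G y)))) *\<^sub>R axis k 1 :: real ^ 'n)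
      differentiable (at x)" for k
    using det x gr by (intro differentiable_scaleR differentiable_mult differentiable_inverse
        differentiable_det differentiable_const) auto
  then have *: "(\<lambda>y. \<Sum>k\<in>UNIV. (det (N y k) * inverse (det (gram (G y)))) *\<^sub>R axis k 1 :: real ^ 'n)
      differentiable (at x)"
    by (intro differentiable_sum) auto
  have "\<Gamma> y u v = (\<Sum>k\<in>UNIV. (det (N y k) * inverse (det (gram (G y)))) *\<^sub>R axis k 1)" if "y \<in> \<Omega>" for y
    using basis_expansion[of "\<Gamma> y u v"] sol[OF that] by (simp add: scalar_mult_eq_scaleR divide_inverse)
  then show ?thesis
    using * has_derivative_transform_within_open[OF _ open_domain x, where g = "\<lambda>y. \<Gamma> y u v"]
    unfolding differentiable_def by fastforce
qed

text \<open>The Leibniz rule for the contraction of the metric with a field \<open>V\<close> in one argument.\<close>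

lemma has_derivative_G_field:
  assumes x: "x \<in> \<Omega>" and V: "V differentiable (at x)"
  shows "((\<lambda>y. G y (V y) d) has_derivative
           (\<lambda>a. dG x a (V x) d + G x (frechet_derivative V (at x) a) d)) (at x)"
proof -
  let ?V' = "frechet_derivative V (at x)"
  have V': "((\<lambda>y. V y $ i) has_derivative (\<lambda>a. ?V' a $ i)) (at x)" for i
    using V bounded_linear.has_derivative[OF bounded_linear_vec_nth] frechet_derivative_works by blast
  have "((\<lambda>y. \<Sum>i\<in>UNIV. V y $ i * G y (axis i 1) d) has_derivative
      (\<lambda>a. \<Sum>i\<in>UNIV. V x $ i * dG x a (axis i 1) d + ?V' a $ i * G x (axis i 1) d)) (at x)"
    by (intro has_derivative_sum has_derivative_mult V' has_derivative_G x)
  moreover have "(\<lambda>a. \<Sum>i\<in>UNIV. V x $ i * dG x a (axis i 1) d + ?V' a $ i * G x (axis i 1) d) =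
      (\<lambda>a. dG x a (V x) d + G x (?V' a) d)"
    unfolding bilinear_expand_left[OF bilinear_dG[OF x], where u = "V x"]
      bilinear_expand_left[OF bilin[OF x], where u = "?V' a" for a] sum.distrib ..
  ultimately have "((\<lambda>y. \<Sum>i\<in>UNIV. V y $ i * G y (axis i 1) d) has_derivative
      (\<lambda>a. dG x a (V x) d + G x (?V' a) d)) (at x)" by simp
  then show ?thesis
    by (rule has_derivative_transform_within_open[OF _ open_domain x])
      (rule bilinear_expand_left[OF bilin, symmetric])
qed

abbreviation d\<Gamma> :: "real ^ 'n \<Rightarrow> real ^ 'n \<Rightarrow> real ^ 'n \<Rightarrow> real ^ 'n \<Rightarrow> real ^ 'n" where
  "d\<Gamma> x a b c \<equiv> frechet_derivative (\<lambda>y. \<Gamma> y b c) (at x) a"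

text \<open>The value at \<open>x\<close> of \<open>\<nabla>\<^sub>a \<nabla>\<^sub>b c\<close> for constant fields \<open>a\<close>, \<open>b\<close> and \<open>c\<close>.\<close>

definition nabla2 :: "real ^ 'n \<Rightarrow> real ^ 'n \<Rightarrow> real ^ 'n \<Rightarrow> real ^ 'n \<Rightarrow> real ^ 'n" where
  "nabla2 x a b c = d\<Gamma> x a b c + \<Gamma> x a (\<Gamma> x b c)"

text \<open>The curvature tensor, evaluated on constant extensions of the three vectors.\<close>

definition curv :: "real ^ 'n \<Rightarrow> real ^ 'n \<Rightarrow> real ^ 'n \<Rightarrow> real ^ 'n \<Rightarrow> real ^ 'n" where
  "curv x a b c = curvature_op G (\<lambda>_. a) (\<lambda>_. b) (\<lambda>_. c) x"

lemma curv_eq_nabla2: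
  assumes "x \<in> \<Omega>"
  shows "curv x a b c = nabla2 x a b c - nabla2 x b a c"
proof -
  have "levi_civita G (\<lambda>_. b) (\<lambda>_. c) = (\<lambda>y. \<Gamma> y b c)" for b c
    by (rule ext) (simp add: levi_civita_def)
  then show ?thesis
    unfolding curv_def curvature_op_def nabla2_def
    by (simp add: levi_civita_def lie_bracket_def christoffel_zero[OF assms])
qed

lemma curv_bianchi:
  assumes x: "x \<in> \<Omega>"
  shows "curv x a b c + curv x b c a + curv x c a b = 0"
proof -
  have "d\<Gamma> x a b c = d\<Gamma> x a c b" for a b c
    using frechet_derivative_transform_within_open[OF christoffel_differentiable[OF x] open_domain x]
      christoffel_sym by metis
  then have s: "nabla2 x a b c = nabla2 x a c b" for a b c
    using christoffel_sym[OF x] by (metis nabla2_def)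
  show ?thesis
    unfolding curv_eq_nabla2[OF x] s[of a c b] s[of b a c] s[of c b a] by simp
qed

text \<open>The derivative of the compatibility identity. The last two terms together are symmetric in \<open>a\<close> and
  \<open>b\<close>.\<close>

lemma second_derivative_metric:
  assumes x: "x \<in> \<Omega>"
  shows "frechet_derivative (\<lambda>y. dG y b c d) (at x) a =
    G x (nabla2 x a b c) d + G x c (nabla2 x a b d)
    + G x (\<Gamma> x b c) (\<Gamma> x a d) + G x (\<Gamma> x a c) (\<Gamma> x b d)"
proof -
  have "((\<lambda>y. G y (\<Gamma> y b c) d + G y (\<Gamma> y b d) c) has_derivative
      (\<lambda>a. (dG x a (\<Gamma> x b c) d + G x (d\<Gamma> x a b c) d) + (dG x a (\<Gamma> x b d) c + G x (d\<Gamma> x a b d) c))) (at x)"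
    by (intro has_derivative_add has_derivative_G_field christoffel_differentiable x)
  then have "((\<lambda>y. dG y b c d) has_derivative
      (\<lambda>a. (dG x a (\<Gamma> x b c) d + G x (d\<Gamma> x a b c) d) + (dG x a (\<Gamma> x b d) c + G x (d\<Gamma> x a b d) c))) (at x)"
    by (rule has_derivative_transform_within_open[OF _ open_domain x])
      (simp add: metric_compatible sym)
  from frechet_derivative_at[OF this, symmetric] show ?thesis
    by (simp add: metric_compatible[OF x] nabla2_def bilinear_ladd bilinear_radd bilin[OF x] sym[OF x])
qed

text \<open>Antisymmetrising the second derivatives of the metric in the directions \<open>a\<close> and \<open>b\<close> gives zero by
  Schwarz's theorem and leaves the curvature terms.\<close>

lemma curv_skew:
  assumes x: "x \<in> \<Omega>"
  shows "G x (curv x a b c) d = - G x (curv x a b d) c"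
proof -
  have "frechet_derivative (\<lambda>y. dG y b c d) (at x) a = frechet_derivative (\<lambda>y. dG y a c d) (at x) b"
    using second_derivative_symmetric[OF C2[of c d] open_domain x] by blast
  then have "G x (nabla2 x a b c) d + G x (nabla2 x a b d) c = G x (nabla2 x b a c) d + G x (nabla2 x b a d) c"
    unfolding second_derivative_metric[OF x]
    using sym[OF x, of c "nabla2 x a b d"] sym[OF x, of c "nabla2 x b a d"]
      sym[OF x, of "\<Gamma> x b c" "\<Gamma> x a d"] sym[OF x, of "\<Gamma> x a c" "\<Gamma> x b d"]
    by linarith
  then show ?thesis
    unfolding curv_eq_nabla2[OF x] bilinear_lsub[OF bilin[OF x]] by linarith
qed

lemma curv_antisym: "x \<in> \<Omega> \<Longrightarrow> curv x a b c = - curv x b a c"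
  by (simp add: curv_eq_nabla2)

end


section \<open>The metric in a chart\<close>

lemma cinv_chart:
  assumes "y \<in> cimage c"
  shows "cinv c y \<in> cdom c" "coord c (cinv c y) = y"
  using assms unfolding cinv_def cimage_def by (auto simp: inv_into_into f_inv_into_f)

lemma cinv_coord:
  assumes "is_chart X c" "p \<in> cdom c"
  shows "cinv c (coord c p) = p"
proof -
  have "inj_on (coord c) (topspace (subtopology X (cdom c)))"
    using assms homeomorphic_imp_injective_map unfolding is_chart_def by blast
  moreover have "topspace (subtopology X (cdom c)) = cdom c"
    using assms openin_subset unfolding is_chart_def by fastforce
  ultimately show ?thesis
    using assms(2) by (simp add: cinv_def)
qed

lemma jacobian_refl:
  assumes "is_chart X c" "p \<in> cdom c"
  shows "jacobian c c p = id"
proof -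
  have "frechet_derivative (\<lambda>x. x) (at (coord c p)) = frechet_derivative (coord c \<circ> cinv c) (at (coord c p))"
    by (rule frechet_derivative_transform_within_open[of _ _ "cimage c"])
      (use assms in \<open>simp_all add: is_chart_def cinv_chart(2), simp add: cimage_def\<close>)
  then show ?thesis by (simp add: jacobian_def id_def)
qed

lemma linear_jacobian:
  assumes M: "smooth_manifold M" and "c \<in> atlas M" "d \<in> atlas M" "q \<in> cdom c" "q \<in> cdom d"
  shows "linear (jacobian c d q)"
proof -
  have "C_on 1 (coord c ` (cdom c \<inter> cdom d)) (coord d \<circ> cinv c)"
    using assms unfolding smooth_manifold_def smooth_on_def by blast
  then have "(coord d \<circ> cinv c) differentiable (at (coord c q))"
    using assms by simp
  then show ?thesis
    unfolding jacobian_def by (rule linear_frechet_derivative)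
qed

text \<open>Tangent vectors at \<open>p\<close> are given by their components in \<open>chart_at M p\<close>, so no change of coordinates
  takes place at \<open>p\<close> itself.\<close>

lemma metric_in_chart_center:
  assumes "smooth_manifold M" "p \<in> points M"
  shows "metric_in_chart M g (chart_at M p) (coord (chart_at M p) p) = g p"
proof -
  have "is_chart (mtop M) (chart_at M p)" "p \<in> cdom (chart_at M p)"
    using assms unfolding smooth_manifold_def by auto
  then show ?thesis
    by (simp add: metric_in_chart_def[abs_def] cinv_coord jacobian_refl)
qed

text \<open>Nondegeneracy at the centre spreads to a neighbourhood, as the Gram determinant is
  continuous; this avoids inverting the transition maps.\<close>

lemma local_metric_chart:
  fixes M :: "('m, 'n::finite) mfd"
  assumes gM: "semi_riemannian_manifold M g" and p: "p \<in> points M"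
  obtains \<Omega> where "local_metric (metric_in_chart M g (chart_at M p)) \<Omega>"
    "coord (chart_at M p) p \<in> \<Omega>"
proof -
  define c where "c = chart_at M p"
  define G where "G = metric_in_chart M g c"
  define \<Omega> where "\<Omega> = cimage c \<inter> (\<lambda>y. det (gram (G y))) -` (- {0})"
  have M: "smooth_manifold M" using gM by (simp add: semi_riemannian_manifold_def)
  have c: "c \<in> atlas M" "p \<in> cdom c" "is_chart (mtop M) c"
    using M p unfolding smooth_manifold_def c_def by auto
  have g: "bilinear (g q)" "g q u v = g q v u" "(\<And>v. g q u v = 0) \<Longrightarrow> u = 0"
    if "q \<in> points M" for q u v
    using gM that unfolding semi_riemannian_manifold_def by blast+
  have C: "C_on k (cimage c) (\<lambda>y. G y u v)" for k u v
    using gM c unfolding semi_riemannian_manifold_def smooth_on_def G_def by blast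
  have open_c: "open (cimage c)" using c by (simp add: is_chart_def)
  have dom: "cinv c y \<in> points M" if "y \<in> cimage c" for y
    using cinv_chart(1)[OF that] c(3) openin_subset unfolding is_chart_def by blast
  have Gy: "G y u v = g (cinv c y) (jacobian c (chart_at M (cinv c y)) (cinv c y) u)
      (jacobian c (chart_at M (cinv c y)) (cinv c y) v)" for y u v
    by (simp add: G_def metric_in_chart_def Let_def)
  have bil: "bilinear (G y)" if y: "y \<in> cimage c" for y
  proof -
    let ?q = "cinv c y"
    have "chart_at M ?q \<in> atlas M" "?q \<in> cdom (chart_at M ?q)"
      using M dom[OF y] unfolding smooth_manifold_def by auto
    then have "linear (jacobian c (chart_at M ?q) ?q)"
      using linear_jacobian[OF M c(1)] cinv_chart(1)[OF y] by blast
    then show ?thesis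
      using g(1)[OF dom[OF y]] unfolding bilinear_def Gy
      by (auto intro: linear_compose[unfolded o_def])
  qed
  have "(\<lambda>y. det (gram (G y))) differentiable (at y)" if "y \<in> cimage c" for y
    using C[of 1] that by (intro differentiable_det) (simp add: gram_def)
  then have "continuous_on (cimage c) (\<lambda>y. det (gram (G y)))"
    by (simp add: continuous_at_imp_continuous_on differentiable_imp_continuous_within)
  then have "open \<Omega>"
    unfolding \<Omega>_def using open_c by (intro continuous_open_preimage) auto
  have "local_metric G \<Omega>"
  proof
    show "u = 0" if "y \<in> \<Omega>" "\<And>v. G y u v = 0" for y u
      using nondegenerate_iff_det_gram[OF bil] that by (auto simp: \<Omega>_def)
    show "C_on 2 \<Omega> (\<lambda>y. G y u v)" for u v
      using C_on_subset[OF C] by (simp add: \<Omega>_def)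
    show "G y u v = G y v u" if "y \<in> \<Omega>" for y u v
      using g(2) dom that by (simp add: \<Omega>_def Gy)
  qed (use \<open>open \<Omega>\<close> bil \<Omega>_def in auto)
  moreover have "coord c p \<in> \<Omega>"
  proof -
    have "G (coord c p) = g p"
      using metric_in_chart_center[OF M p] by (simp add: G_def c_def)
    then show ?thesis
      using nondegenerate_iff_det_gram[OF g(1)[OF p]] g(3)[OF p] c(2)
      by (auto simp: \<Omega>_def cimage_def)
  qed
  ultimately show thesis using that by (simp add: G_def c_def)
qed


section \<open>Algebraic curvature tensors\<close>

text \<open>In terms of the Gram matrix \<open>N\<inverse>\<close> of \<open>B\<close>, adjointness says \<open>F = N H\<^sup>t N\<inverse>\<close> for the matrices \<open>F\<close> and
  \<open>H\<close> of the two maps. Linearity of \<open>f\<close> and \<open>h\<close> is not assumed, as it follows from adjointness.\<close>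

lemma trace_adjoint:
  fixes B :: "real ^ 'n \<Rightarrow> real ^ 'n \<Rightarrow> real" and f h :: "real ^ 'n \<Rightarrow> real ^ 'n::finite"
  assumes B: "bilinear B" "\<And>u v. B u v = B v u" "\<And>u. (\<And>v. B u v = 0) \<Longrightarrow> u = 0"
    and adj: "\<And>x w. B (f x) w = B x (h w)"
  shows "trace (matrix f) = trace (matrix h)"
proof -
  have "det (gram B) \<noteq> 0" using nondegenerate_iff_det_gram[OF B(1)] B(3) by blast
  then obtain N where N: "gram B ** N = mat 1" "N ** gram B = mat 1"
    using invertible_det_nz unfolding invertible_def by blast
  have entry: "(gram B ** matrix f') $ j $ i = B (f' (axis i 1)) (axis j 1)" for f' i j
    unfolding gram_mult[OF B(1), symmetric] by (simp add: matrix_matrix_mult_def matrix_vector_mult_def matrix_def)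
  have "gram B ** matrix f = transpose (gram B ** matrix h)"
    by (simp add: vec_eq_iff entry transpose_def adj B(2)[of "axis _ 1"])
  also have "\<dots> = transpose (matrix h) ** gram B"
    using B(2) by (simp add: matrix_transpose_mul) (simp add: gram_def transpose_def)
  finally have "matrix f = N ** (transpose (matrix h) ** gram B)"
    using N by (metis matrix_mul_assoc matrix_mul_lid)
  then have "trace (matrix f) = trace ((transpose (matrix h) ** gram B) ** N)"
    by (simp only: trace_mul_sym[of N])
  also have "\<dots> = trace (transpose (matrix h))"
    by (simp add: matrix_mul_assoc[symmetric] N)
  also have "\<dots> = trace (matrix h)"
    by (simp add: trace_def transpose_def)
  finally show ?thesis .
qed

text \<open>A scalar product on a tangent space together with a map that has the symmetries of a curvature
  tensor. Multilinearity of \<open>R\<close> is not required, as it is a consequence of the pair symmetry.\<close>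

locale algebraic_curvature =
  fixes g :: "real ^ 'n \<Rightarrow> real ^ 'n \<Rightarrow> real"
    and R :: "real ^ 'n \<Rightarrow> real ^ 'n \<Rightarrow> real ^ 'n \<Rightarrow> real ^ 'n::finite"
  assumes bilin: "bilinear g"
    and sym: "g u v = g v u"
    and nondeg: "(\<And>v. g u v = 0) \<Longrightarrow> u = 0"
    and antisym: "R x y z = - R y x z"
    and skew: "g (R x y z) w = - g (R x y w) z"
    and bianchi: "R x y z + R y z x + R z x y = 0"
begin

lemmas g_simps = bilinear_ladd[OF bilin] bilinear_radd[OF bilin] bilinear_lsub[OF bilin]
  bilinear_rsub[OF bilin] bilinear_lmul[OF bilin] bilinear_rmul[OF bilin]
  bilinear_lneg[OF bilin] bilinear_rneg[OF bilin]

lemma eq_by_pairing: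
  assumes "\<And>w. g u w = g v w"
  shows "u = v"
proof -
  have "g (u - v) w = 0" for w by (simp add: g_simps assms)
  then have "u - v = 0" by (rule nondeg)
  then show ?thesis by simp
qed

text \<open>The Bianchi identities in \<open>x, y, z\<close> and in \<open>y, z, w\<close>, minus those in \<open>z, w, x\<close> and in \<open>w, x, y\<close>, each
  paired with the remaining vector: the two antisymmetries leave twice the claim.\<close>

lemma pair_symmetry: "g (R x y z) w = g (R z w x) y"
proof -
  have B: "g (R x y z) w + g (R y z x) w + g (R z x y) w = 0" for x y z w
    using bilinear_lzero[OF bilin, of w] unfolding bianchi[of x y z, symmetric] g_simps .
  have A: "g (R x y z) w = - g (R y x z) w" for x y z w
    unfolding antisym[of x y z] g_simps ..
  show ?thesis
    using B[of x y z w] B[of y z w x] B[of z w x y] B[of w x y z]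
      skew[of x y z w] skew[of y z x w] skew[of z x y w] skew[of y z w x] skew[of z w y x]
      skew[of w y z x] skew[of z w x y] skew[of w x z y] skew[of x z w y]
      skew[of w x y z] skew[of x y w z] skew[of y w x z]
      A[of z x w y] A[of y w z x] A[of y w x z] A[of x z w y] A[of z x y w] A[of w y z x]
    by argo
qed

lemma linear_R: "linear (R x y)"
proof (intro linearI eq_by_pairing)
  fix z z' w
  show "g (R x y (z + z')) w = g (R x y z + R x y z') w"
    unfolding g_simps skew[of x y _ w] by simp
next
  fix c z w
  show "g (R x y (c *\<^sub>R z)) w = g (c *\<^sub>R R x y z) w"
    unfolding g_simps skew[of x y _ w] by simp
qed

text \<open>The Ricci tensor and the Ricci operator of \<open>R\<close>.\<close>

definition ric :: "real ^ 'n \<Rightarrow> real ^ 'n \<Rightarrow> real" where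
  "ric y z = trace (matrix (\<lambda>x. R x y z))"

definition Q :: "real ^ 'n \<Rightarrow> real ^ 'n" where
  "Q x = (THE q. \<forall>y. g q y = ric x y)"

lemma ric_sum: "ric y z = (\<Sum>i\<in>UNIV. R (axis i 1) y z $ i)"
  by (simp add: ric_def trace_def matrix_def)

text \<open>By the symmetries of \<open>R\<close> the maps \<open>x \<mapsto> R x y z\<close> and \<open>w \<mapsto> R w z y\<close> are adjoint to each other.\<close>

lemma ric_sym: "ric y z = ric z y"
  unfolding ric_def
proof (rule trace_adjoint[OF bilin sym nondeg])
  fix x w
  have "g (R x y z) w = g (R z w x) y" by (rule pair_symmetry)
  also have "\<dots> = g (R w z y) x"
    by (subst antisym) (simp add: g_simps skew[of w z x y])
  finally show "g (R x y z) w = g x (R w z y)" by (simp add: sym[of x])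
qed

lemma bilinear_ric: "bilinear ric"
proof -
  have l: "linear (ric y)" for y
    by (rule linearI)
      (simp_all add: ric_sum linear_add[OF linear_R] linear_cmul[OF linear_R] sum.distrib sum_distrib_left)
  moreover have "(\<lambda>y. ric y z) = ric z" for z by (rule ext) (rule ric_sym)
  ultimately show ?thesis by (simp add: bilinear_def)
qed

lemmas ric_simps = bilinear_ladd[OF bilinear_ric] bilinear_radd[OF bilinear_ric]
  bilinear_lsub[OF bilinear_ric] bilinear_rsub[OF bilinear_ric] bilinear_lmul[OF bilinear_ric]
  bilinear_rmul[OF bilinear_ric] bilinear_lneg[OF bilinear_ric] bilinear_rneg[OF bilinear_ric]

lemma g_Q: "g (Q x) y = ric x y"
proof -
  have "linear (ric x)" using bilinear_ric by (simp add: bilinear_def)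
  from theI'[OF riesz_nondegenerate[OF bilin nondeg this]] show ?thesis
    by (simp add: Q_def)
qed

lemma g_Q_right: "g x (Q y) = ric x y"
  unfolding sym[of x] g_Q by (rule ric_sym)

lemma ric_Q_right: "ric x (Q y) = ric (Q x) y"
  using g_Q[of x "Q y"] g_Q_right[of "Q x" y] by simp

lemma ric_Q_sym: "ric (Q x) y = ric (Q y) x"
  using ric_Q_right[of x y] ric_sym[of x "Q y"] by simp

end


section \<open>Unit vectors in the nullity space\<close>

text \<open>The situation at one point: \<open>\<xi>\<close> lies in the \<open>k\<close>-nullity space of \<open>R\<close> and \<open>g \<xi> \<xi> = \<epsilon>\<close>, where
  \<open>\<epsilon>\<close> may be any real number.\<close>

locale nullity_vector = algebraic_curvature g R
  for g :: "real ^ 'n \<Rightarrow> real ^ 'n \<Rightarrow> real"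
    and R :: "real ^ 'n \<Rightarrow> real ^ 'n \<Rightarrow> real ^ 'n \<Rightarrow> real ^ 'n::finite" +
  fixes k \<epsilon> :: real and \<xi> :: "real ^ 'n"
  assumes xi_norm: "g \<xi> \<xi> = \<epsilon>"
    and nullity: "R x y \<xi> = k *\<^sub>R (g y \<xi> *\<^sub>R x - g x \<xi> *\<^sub>R y)"
begin

text \<open>The eigenvalue of the Ricci operator at \<open>\<xi>\<close>.\<close>

definition K :: real where "K = k * (real CARD('n) - 1)"

lemma ric_xi: "ric y \<xi> = K * g y \<xi>"
proof -
  have "ric y \<xi> = (\<Sum>i\<in>UNIV. k * (g y \<xi> - y $ i * g (axis i 1) \<xi>))"
    by (simp add: ric_sum nullity algebra_simps)
  also have "\<dots> = k * (real CARD('n) * g y \<xi> - (\<Sum>i\<in>UNIV. y $ i * g (axis i 1) \<xi>))"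
    by (simp add: sum_distrib_left[symmetric] sum_subtractf)
  also have "\<dots> = K * g y \<xi>"
    by (simp add: bilinear_expand_left[OF bilin, of y, symmetric] K_def algebra_simps)
  finally show ?thesis .
qed

lemma Q_xi: "Q \<xi> = K *\<^sub>R \<xi>"
  by (rule eq_by_pairing) (simp add: g_Q g_simps ric_sym[of \<xi>] ric_xi sym[of \<xi>])

lemma g_R_xi: "g (R x y z) \<xi> = k * (g y z * g x \<xi> - g x z * g y \<xi>)"
  unfolding skew[of x y z \<xi>] nullity g_simps by (simp add: algebra_simps)

lemma R_xi: "R \<xi> x z = k *\<^sub>R (g x z *\<^sub>R \<xi> - g z \<xi> *\<^sub>R x)"
proof (rule eq_by_pairing)
  fix w
  show "g (R \<xi> x z) w = g (k *\<^sub>R (g x z *\<^sub>R \<xi> - g z \<xi> *\<^sub>R x)) w"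
    unfolding pair_symmetry[of \<xi> x z w] nullity g_simps sym[of z x] sym[of w] by (simp add: algebra_simps)
qed

text \<open>The tensor \<open>\<T>\<^sub>c\<close>, with the scalar curvature replaced by an arbitrary number \<open>r\<close>.\<close>

definition T :: "(nat \<Rightarrow> real) \<Rightarrow> real \<Rightarrow> real ^ 'n \<Rightarrow> real ^ 'n \<Rightarrow> real ^ 'n \<Rightarrow> real ^ 'n" where
  "T c r x y z =
       c 0 *\<^sub>R R x y z
     + (c 1 * ric y z) *\<^sub>R x + (c 2 * ric x z) *\<^sub>R y
     + (c 3 * ric x y) *\<^sub>R z
     + (c 4 * g y z) *\<^sub>R Q x + (c 5 * g x z) *\<^sub>R Q y
     + (c 6 * g x y) *\<^sub>R Q z
     + (c 7 * r) *\<^sub>R (g y z *\<^sub>R x - g x z *\<^sub>R y)"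

lemma g_T_xi:
  "g (T c r x y z) \<xi> =
     (k * c 0 + K * c 4 + c 7 * r) * g y z * g x \<xi>
     + (- k * c 0 + K * c 5 - c 7 * r) * g x z * g y \<xi>
     + c 1 * ric y z * g x \<xi> + c 2 * ric x z * g y \<xi> + c 3 * ric x y * g z \<xi>
     + K * c 6 * g x y * g z \<xi>"
  unfolding T_def g_simps g_R_xi g_Q ric_xi by (simp add: algebra_simps)

lemma T_xi:
  "T c r \<xi> x z =
     ((k * c 0 + K * c 4 + c 7 * r) * g x z + c 1 * ric x z) *\<^sub>R \<xi>
     + ((- k * c 0 + K * c 2 - c 7 * r) * g z \<xi>) *\<^sub>R x
     + (K * c 3 * g x \<xi>) *\<^sub>R z + (c 5 * g z \<xi>) *\<^sub>R Q x + (c 6 * g x \<xi>) *\<^sub>R Q z"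
  unfolding T_def R_xi Q_xi ric_sym[of \<xi>] ric_xi sym[of \<xi>] by (simp add: algebra_simps)

lemma g_T_xi_xi:
  "g (T c r \<xi> x z) \<xi> =
     \<epsilon> * ((k * c 0 + K * c 4 + c 7 * r) * g x z + c 1 * ric x z)
     + (- k * c 0 + K * (c 2 + c 3 + c 5 + c 6) - c 7 * r) * g x \<xi> * g z \<xi>"
  unfolding T_xi g_simps g_Q ric_xi xi_norm by (simp add: algebra_simps)

text \<open>The derivation condition for the endomorphism \<open>\<T>\<^sub>a(\<xi>, x)\<close>, paired with \<open>\<xi>\<close>.\<close>

lemma semisymmetric_xi_component:
  assumes "derivation_action (T a r \<xi> x) (T b r) u v w = 0"
  shows "g (T a r \<xi> x (T b r u v w)) \<xi> = g (T b r (T a r \<xi> x u) v w) \<xi>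
    + g (T b r u (T a r \<xi> x v) w) \<xi> + g (T b r u v (T a r \<xi> x w)) \<xi>"
proof -
  have "T a r \<xi> x (T b r u v w) =
      T b r (T a r \<xi> x u) v w + T b r u (T a r \<xi> x v) w + T b r u v (T a r \<xi> x w)"
    using assms unfolding derivation_action_def by (simp add: algebra_simps)
  then show ?thesis by (simp add: g_simps)
qed

end


section \<open>The identity for semisymmetric manifolds\<close>

lemma nullity_vector_at:
  fixes M :: "('m, 'n::finite) mfd"
  assumes N: "Nk_semi_riemannian_manifold M g k \<xi> \<epsilon>" and p: "p \<in> points M"
  shows "nullity_vector (g p) (Riem M g p) k \<epsilon> (\<xi> p)"
proof -
  define c where "c = chart_at M p"
  have gM: "semi_riemannian_manifold M g" using N by (simp add: Nk_semi_riemannian_manifold_def)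
  then have M: "smooth_manifold M" by (simp add: semi_riemannian_manifold_def)
  obtain \<Omega> where L: "local_metric (metric_in_chart M g c) \<Omega>" and x: "coord c p \<in> \<Omega>"
    using local_metric_chart[OF gM p] unfolding c_def by blast
  interpret L: local_metric "metric_in_chart M g c" \<Omega> by (rule L)
  have G: "metric_in_chart M g c (coord c p) = g p"
    unfolding c_def by (rule metric_in_chart_center[OF M p])
  have R: "Riem M g p = L.curv (coord c p)"
    by (intro ext) (simp add: Riem_def L.curv_def c_def[symmetric])
  show ?thesis
  proof
    show "bilinear (g p)" using L.bilin[OF x] by (simp add: G)
    show "g p u v = g p v u" for u v using L.sym[OF x, of u v] by (simp add: G)
    show "u = 0" if "\<And>v. g p u v = 0" for u using L.nondeg[OF x, of u] that by (simp add: G)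
    show "Riem M g p x y z = - Riem M g p y x z" for x y z
      unfolding R by (rule L.curv_antisym[OF x])
    show "g p (Riem M g p x y z) w = - g p (Riem M g p x y w) z" for x y z w
      using L.curv_skew[OF x] unfolding R G .
    show "Riem M g p x y z + Riem M g p y z x + Riem M g p z x y = 0" for x y z
      unfolding R by (rule L.curv_bianchi[OF x])
    show "g p (\<xi> p) (\<xi> p) = \<epsilon>"
      using N p by (simp add: Nk_semi_riemannian_manifold_def)
    show "Riem M g p x y (\<xi> p) = k *\<^sub>R (g p y (\<xi> p) *\<^sub>R x - g p x (\<xi> p) *\<^sub>R y)" for x y
      using N p by (auto simp: Nk_semi_riemannian_manifold_def nullity_def)
  qed
qed

lemma Let_diagonalI:
  "(\<And>a b. P a b \<Longrightarrow> J a b) \<Longrightarrow>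
     let I = J in (\<forall>a b. P a b \<longrightarrow> I a b) \<and> (\<forall>a. P a a \<longrightarrow> I a a)"
  by simp

lemma eq_if_difference_eq: "(s :: real) = t \<Longrightarrow> q - p = s - t \<Longrightarrow> p = q"
  by simp

theorem theorem6p2:
  fixes M :: "('m, 'n::finite) mfd" and g :: "('m, 'n) metric"
    and k \<epsilon> :: real and \<xi> :: "'m \<Rightarrow> real ^ 'n"
  assumes "Nk_semi_riemannian_manifold M g k \<xi> \<epsilon>"
  shows "let Identity = (\<lambda>a b :: nat \<Rightarrow> real.
    \<forall>X U V W. vector_field M X \<and> vector_field M U \<and> vector_field M V \<and> vector_field M W \<longrightarrow>
    (\<forall>p\<in>points M.
      let n = real CARD('n); r = scalar_curv M g p; \<eta> = eta g \<xi> \<epsilon> p;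
          G = g p; R = Riem M g p; R4 = Riem4 M g p; S = Ricci M g p; S2 = Ricci2 M g p;
          x = X p; u = U p; v = V p; w = W p
      in
        - \<epsilon> * b 0 * (k * a 0 + k * (n - 1) * a 4 + a 7 * r) * R4 u v w x
        - \<epsilon> * a 1 * b 0 * S x (R u v w)
      =
        - 2 * k * (n - 1) * a 3 * (k * b 0 + k * (n - 1) * b 4 + b 7 * r) * \<eta> x * \<eta> u * G v w
        - 2 * k * (n - 1) * a 3 * (- k * b 0 + k * (n - 1) * b 5 - b 7 * r) * \<eta> x * \<eta> v * G u w
        + \<epsilon> * a 1 * b 4 * S2 x u * G v w
        + \<epsilon> * a 1 * b 5 * S2 x v * G u w
        + \<epsilon> * a 1 * b 6 * S2 x w * G u v
        - a 5 * (b 1 + b 3) * S2 x v * \<eta> u * \<eta> w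
        - a 5 * (b 1 + b 2) * S2 x w * \<eta> u * \<eta> v
        - a 5 * (b 2 + b 3) * S2 x u * \<eta> v * \<eta> w
        - 2 * a 6 * b 1 * S2 v w * \<eta> x * \<eta> u
        - 2 * a 6 * b 2 * S2 u w * \<eta> x * \<eta> v
        - 2 * a 6 * b 3 * S2 u v * \<eta> x * \<eta> w
        - 2 * k^2 * (n - 1)^2 * a 3 * b 6 * G u v * \<eta> x * \<eta> w
        - 2 * (k * (n - 1) * a 3 * b 1 + a 6 * (k * b 0 + k * (n - 1) * b 4 + b 7 * r))
            * \<eta> x * \<eta> u * S v w
        - 2 * (k * (n - 1) * a 3 * b 2 + a 6 * (- k * b 0 + k * (n - 1) * b 5 - b 7 * r))
            * \<eta> x * \<eta> v * S u w
        - 2 * k * (n - 1) * (a 3 * b 3 + a 6 * b 6) * S u v * \<eta> x * \<eta> w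
        + \<epsilon> * (b 4 * (k * a 0 + k * (n - 1) * a 4 + a 7 * r)
               - a 1 * (k * b 0 + k * (n - 1) * b 4)) * S x u * G v w
        + \<epsilon> * (b 5 * (k * a 0 + k * (n - 1) * a 4 + a 7 * r)
               - a 1 * (- k * b 0 + k * (n - 1) * b 5)) * S x v * G u w
        + \<epsilon> * b 6 * (k * a 0 + k * (n - 1) * (a 4 - a 1) + a 7 * r) * S x w * G u v
        - \<epsilon> * (k * b 0 + k * (n - 1) * b 4) * (k * a 0 + k * (n - 1) * a 4 + a 7 * r)
            * G x u * G v w
        - \<epsilon> * (- k * b 0 + k * (n - 1) * b 5) * (k * a 0 + k * (n - 1) * a 4 + a 7 * r)
            * G u w * G x v
        - \<epsilon> * k * (n - 1) * b 6 * (k * a 0 + k * (n - 1) * a 4 + a 7 * r) * G x w * G u v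
        - k * (n - 1) * ((b 2 + b 3) * (k * a 0 + k * (n - 1) * a 4 + a 7 * r)
               + (a 2 + a 4) * (- k * b 0 + k * (n - 1) * (b 5 + b 6) - b 7 * r))
            * G x u * \<eta> v * \<eta> w
        - k * (n - 1) * ((b 1 + b 3) * (k * a 0 + k * (n - 1) * a 4 + a 7 * r)
               + (a 2 + a 4) * (k * b 0 + k * (n - 1) * (b 4 + b 6) + b 7 * r))
            * G x v * \<eta> u * \<eta> w
        - ((b 1 + b 3) * (- k * a 0 + k * (n - 1) * (a 1 + a 2) - a 7 * r)
               + (a 1 + a 5) * (k * b 0 + k * (n - 1) * (b 4 + b 6) + b 7 * r))
            * S x v * \<eta> u * \<eta> w
        - ((b 2 + b 3) * (- k * a 0 + k * (n - 1) * (a 1 + a 2) - a 7 * r)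
               + (a 1 + a 5) * (- k * b 0 + k * (n - 1) * (b 5 + b 6) - b 7 * r))
            * S x u * \<eta> v * \<eta> w
        - ((b 1 + b 2) * (- k * a 0 + k * (n - 1) * (a 1 + a 2) - a 7 * r)
               + k * (n - 1) * (b 4 + b 5) * (a 1 + a 5))
            * S x w * \<eta> u * \<eta> v
        - k * (n - 1) * (k * (n - 1) * (b 4 + b 5) * (a 2 + a 4)
               + (b 1 + b 2) * (k * a 0 + k * (n - 1) * a 4 + a 7 * r))
            * G x w * \<eta> u * \<eta> v))
    in (\<forall>a b. T_semisymmetric M g a b \<longrightarrow> Identity a b) \<and>
       (\<forall>a. T_semisymmetric M g a a \<longrightarrow> Identity a a)"
proof (rule Let_diagonalI, intro allI impI ballI, elim conjE, goal_cases)
  case (1 a b X U V W p)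
  define x u v w z m where xuvw: "x = X p" "u = U p" "v = V p" "w = W p" "z = \<xi> p"
    and m: "m = real CARD('n) - 1"
  define r where "r = scalar_curv M g p"
  interpret N: nullity_vector "g p" "Riem M g p" k \<epsilon> z
    unfolding xuvw by (rule nullity_vector_at[OF assms \<open>p \<in> points M\<close>])
  have ric: "Ricci M g p = N.ric"
    by (intro ext) (simp add: Ricci_def N.ric_def)
  have Q: "Ricci_op M g p = N.Q"
    by (intro ext) (simp add: Ricci_op_def N.Q_def ric)
  have T: "T_curv M g c p = N.T c r" for c
    by (intro ext) (simp add: T_curv_def N.T_def ric Q r_def)
  have K: "N.K = k * m" by (simp add: N.K_def m)
  have "derivation_action (N.T a r z x) (N.T b r) u v w = 0"
    using 1 by (simp add: T_semisymmetric_def T[symmetric])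
  note E = N.semisymmetric_xi_component[OF this]
  \<comment> \<open>The order in which the claim has the arguments of the symmetric forms.\<close>
  note swap = N.sym[of z u] N.sym[of z v] N.sym[of z w]
    N.sym[of u x] N.sym[of v x] N.sym[of w x]
    N.ric_sym[of u x] N.ric_sym[of v x] N.ric_sym[of w x]
    N.ric_Q_sym[of u x] N.ric_Q_sym[of v x] N.ric_Q_sym[of w x]
  have \<epsilon>: "\<epsilon> * \<epsilon> = 1"
    using assms by (auto simp: Nk_semi_riemannian_manifold_def)
  have \<epsilon>': "\<epsilon> * (\<epsilon> * t) = t" for t
    using \<epsilon> by (simp add: mult.assoc[symmetric])
  \<comment> \<open>The scalars are abbreviated, and \<open>g(y, \<xi>)\<close> is written as \<open>\<epsilon> \<eta>(y)\<close>; what remains is an identity between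
    polynomials modulo \<open>\<epsilon>\<^sup>2 = 1\<close>.\<close>
  define G S S2 R4 \<eta> where "G = g p" "S = Ricci M g p" "S2 = Ricci2 M g p" "R4 = Riem4 M g p"
    "\<eta> = eta g \<xi> \<epsilon> p"
  have G: "g p y y' = G y y'" and S: "N.ric y y' = S y y'" and S2: "N.ric (N.Q y) y' = S2 y y'"
    and R4: "g p y (Riem M g p y1 y2 y3) = R4 y1 y2 y3 y" and \<eta>: "g p y z = \<epsilon> * \<eta> y" for y y' y1 y2 y3
    using \<epsilon>' by (simp_all add: G_S_S2_R4_\<eta>_def Ricci2_def ric Q Riem4_def N.sym[of y] eta_def xuvw)
  \<comment> \<open>All occurrences of \<open>\<T>\<^sub>a\<close> are expanded first. This leaves the \<open>\<xi>\<close>-components of values of \<open>\<T>\<^sub>b\<close>, and of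
    \<open>Y = \<T>\<^sub>b(u, v)w\<close> moreover \<open>g(x, Y)\<close> and \<open>S(x, Y)\<close>, for which \<open>\<T>\<^sub>b\<close> itself is expanded.\<close>
  note E1 = E[unfolded N.g_T_xi_xi N.T_xi[of a r x u] N.T_xi[of a r x v] N.T_xi[of a r x w]]
  note E2 = E1[unfolded N.g_T_xi]
  note E3 = E2[unfolded N.T_def[of b r u v w] N.g_simps N.ric_simps N.g_Q N.g_Q_right]
  note E4 = E3[unfolded N.ric_Q_right N.ric_xi N.ric_sym[of z] N.xi_norm swap K real_scaleR_def]
  note E5 = E4[unfolded \<eta> S2, unfolded R4, unfolded G S]
  show ?case
    unfolding Let_def xuvw(1-4)[symmetric] m[symmetric] r_def[symmetric] G_S_S2_R4_\<eta>_def[symmetric]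
    by (rule eq_if_difference_eq[OF E5]) (simp add: algebra_simps power2_eq_square \<epsilon> \<epsilon>')
qed

end
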